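(* The non-abelian almost complex hom-Lie algebras of dimension $2$ are exactly those of the form $(\mathfrak{g},[\cdot,\cdot],\widehat{\phi},\widehat{J})$, where $\mathfrak{g}$ is a $2$-dimensional real vector space with a basis $\{e_1,e_2\}$ such that $[e_1,e_2]=e_2$, the map $\widehat{\phi}$ is the identity ($\widehat{\phi}(e_1)=e_1$, $\widehat{\phi}(e_2)=e_2$), and $\widehat{J}$ has the matrix presentation $$[\widehat{J}]=\begin{bmatrix} a&b\\ c&-a\end{bmatrix},\qquad a,b,c\in\mathbb{R},\quad a^2+bc=-1,$$ that is, $\widehat{J}(e_1)=ae_1+be_2$ and $\widehat{J}(e_2)=ce_1-ae_2$.
   Context: All vector spaces are real. A hom-Lie algebra is a triple $(\mathfrak{g},[\cdot,\cdot],\phi)$ where $\mathfrak{g}$ is a vector space, $[\cdot,\cdot]:\mathfrak{g}\times\mathfrak{g}\to\mathfrak{g}$ is bilinear with $[u,v]=-[v,u]$, $\phi:\mathfrak{g}\to\mathfrak{g}$ is linear with $\phi([u,v])=[\phi(u),\phi(v)]$, and the hom-Jacobi identity $[\phi(u),[v,w]]+[\phi(v),[w,u]]+[\phi(w),[u,v]]=0$ holds for all $u,v,w$. It is involutive if $\phi^2=\mathrm{Id}$, and non-abelian if the bracket is not identically zero. An almost complex structure on an involutive hom-Lie algebra $(\mathfrak{g},[\cdot,\cdot],\phi)$ is a linear isomorphism $J:\mathfrak{g}\to\mathfrak{g}$ with $J^2=-\mathrm{Id}_{\mathfrak{g}}$ and $\phi\circ J=J\circ\phi$; then $(\mathfrak{g},[\cdot,\cdot],\phi,J)$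 is called an almost complex hom-Lie algebra. *)

theory Defs
  imports "HOL-Analysis.Analysis"
begin

locale hom_lie_algebra =
  fixes bracket :: "'g::real_vector \<Rightarrow> 'g \<Rightarrow> 'g"
    and \<phi> :: "'g \<Rightarrow> 'g"
  assumes bilinear_bracket: "bilinear bracket"
    and skew: "bracket u v = - bracket v u"
    and linear_phi: "linear \<phi>"
    and phi_bracket: "\<phi> (bracket u v) = bracket (\<phi> u) (\<phi> v)"
    and hom_jacobi: "bracket (\<phi> u) (bracket v w) + bracket (\<phi> v) (bracket w u)
                       + bracket (\<phi> w) (bracket u v) = 0"

locale involutive_hom_lie_algebra = hom_lie_algebra +
  assumes involutive: "\<phi> \<circ> \<phi> = id"

locale almost_complex_hom_lie_algebra = involutive_hom_lie_algebra bracket \<phi>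
  for bracket :: "'g::real_vector \<Rightarrow> 'g \<Rightarrow> 'g" and \<phi> :: "'g \<Rightarrow> 'g" +
  fixes J :: "'g \<Rightarrow> 'g"
  assumes linear_J: "linear J"
    and bij_J: "bij J"
    and J_squared: "J \<circ> J = uminus"
    and phi_J_commute: "\<phi> \<circ> J = J \<circ> \<phi>"

definition non_abelian :: "('g::real_vector \<Rightarrow> 'g \<Rightarrow> 'g) \<Rightarrow> bool" where
  "non_abelian bracket \<longleftrightarrow> (\<exists>u v. bracket u v \<noteq> 0)"

text \<open>The condition \<^term>\<open>e1 \<noteq> e2\<close> is needed because the set \<^term>\<open>{e1, e2}\<close> collapses otherwise.\<close>

definition is_basis2 :: "'g::real_vector \<Rightarrow> 'g \<Rightarrow> bool" where
  "is_basis2 e1 e2 \<longleftrightarrow> e1 \<noteq> e2 \<and> independent {e1, e2} \<and> span {e1, e2} = UNIV"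

end

theory Submission
  imports Defs
begin

text \<open>An almost complex structure \<open>J\<close> turns a real plane into a complex line. Hence every \<open>x \<noteq> 0\<close>
  yields a basis \<open>x, J x\<close> (lemma \<open>spanning_with_J\<close>), and every \<open>J\<close>-invariant subspace is trivial or
  everything.

  Apply this to the fixed vectors of \<open>\<phi>\<close>, a \<open>J\<close>-invariant subspace that contains all
  \<open>\<phi> x + x\<close>: the involution \<open>\<phi>\<close> is the identity or its negative. Since \<open>\<phi>\<close> preserves
  the bracket, the negative would force \<open>[u, v] = -[u, v]\<close>, so it is excluded by non-commutativity
  (lemma \<open>phi_eq_identity\<close>).

  An alternating bracket on a plane is a determinant times a fixed vector \<open>w = [u, J u]\<close>. In the
  basis \<open>w, J w\<close> the vectors \<open>u, J u\<close> have determinant \<open>p\<^sup>2 + q\<^sup>2\<close>, the squared modulus of the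
  complex number \<open>p + q i\<close> with \<open>u = (p + q i) w\<close>. So \<open>e2 = w\<close> and a multiple
  \<open>e1\<close> of \<open>J w\<close> satisfy \<open>[e1, e2] = e2\<close>, and in this basis \<open>J\<close> even has zero diagonal
  (lemma \<open>normal_form_basis\<close>).

  Conversely, \<open>[e1, e2] = e2\<close> determines the bracket by bilinearity and skew-symmetry, and
  hom-Jacobi becomes a polynomial identity in coordinates (lemma \<open>jacobi_on_plane\<close>).\<close>

section \<open>Bases of a real plane\<close>

lemma is_basis2_coordinates:
  assumes "is_basis2 e1 e2"
  obtains s t where "x = s *\<^sub>R e1 + t *\<^sub>R e2"
proof -
  have "x \<in> span {e1, e2}"
    using assms by (simp add: is_basis2_def)
  then obtain s where "x - s *\<^sub>R e1 \<in> span {e2}"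
    by (auto simp: span_breakdown_eq)
  then obtain t where "x - s *\<^sub>R e1 = t *\<^sub>R e2"
    by (auto simp: span_singleton)
  then have "x = s *\<^sub>R e1 + t *\<^sub>R e2"
    by (simp add: algebra_simps)
  then show thesis
    by (rule that)
qed

lemma linear_eq_on_basis2:
  assumes "linear f" "linear g" "is_basis2 e1 e2" "f e1 = g e1" "f e2 = g e2"
  shows "f = g"
proof
  fix x
  obtain s t where "x = s *\<^sub>R e1 + t *\<^sub>R e2"
    using assms(3) by (rule is_basis2_coordinates)
  then show "f x = g x"
    using assms by (simp add: linear_add linear_cmul)
qed

lemma dim_UNIV_eq_2_if_is_basis2:
  fixes e1 e2 :: "'g::real_vector"
  assumes "is_basis2 e1 e2"
  shows "dim (UNIV :: 'g set) = 2"
proof -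
  have "dim (UNIV :: 'g set) = card {e1, e2}"
    using assms by (intro dim_unique) (auto simp: is_basis2_def)
  also have "\<dots> = 2"
    using assms by (simp add: is_basis2_def)
  finally show ?thesis .
qed

text \<open>The class \<open>real_vector\<close> includes infinite-dimensional spaces, but those have \<open>dim\<close> equal to
  \<open>0\<close>; a nonzero \<open>dim\<close> therefore provides a finite spanning set, and a third independent vector
  would exceed its cardinality.\<close>

lemma is_basis2_if_not_in_span:
  fixes x y :: "'g::real_vector"
  assumes "dim (UNIV :: 'g set) = 2" "x \<noteq> 0" "y \<notin> span {x}"
  shows "is_basis2 x y"
proof -
  have "independent {x}"
    using assms(2) by (simp add: dependent_single)
  then have indep: "independent {x, y}"
    using independent_insertI[OF assms(3)] by (simp add: insert_commute)
  have "x \<noteq> y"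
    using assms(3) by (auto simp: span_base)
  obtain B :: "'g set" where B: "UNIV \<subseteq> span B" "card B = dim (UNIV :: 'g set)"
    using basis_exists by blast
  have "finite B"
    using B(2) assms(1) by (intro card_ge_0_finite) simp
  have "z \<in> span {x, y}" for z
  proof (rule ccontr)
    assume z: "z \<notin> span {x, y}"
    then have "independent (insert z {x, y})"
      using indep by (rule independent_insertI)
    then have "card (insert z {x, y}) \<le> card B"
      using independent_span_bound[OF \<open>finite B\<close>] B(1) by blast
    moreover have "z \<notin> {x, y}"
      using z span_base by blast
    ultimately show False
      using assms(1) \<open>x \<noteq> y\<close> B(2) by simp
  qed
  then show ?thesis
    using indep \<open>x \<noteq> y\<close> by (auto simp: is_basis2_def)
qed

section \<open>Alternating brackets on a plane\<close>

lemma eq_minus_self_imp_zero: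
  fixes x :: "'g::real_vector"
  assumes "x = - x"
  shows "x = 0"
proof -
  have "2 *\<^sub>R x = x + x"
    by (rule scaleR_2)
  also have "\<dots> = 0"
    using assms by (metis add.right_inverse)
  finally show ?thesis
    by simp
qed

lemma skew_bracket_self:
  fixes bracket :: "'g \<Rightarrow> 'g \<Rightarrow> 'h::real_vector"
  assumes "\<And>u v. bracket u v = - bracket v u"
  shows "bracket x x = 0"
  using assms by (rule eq_minus_self_imp_zero)

lemma bracket_determinant:
  assumes "bilinear bracket" and skew: "\<And>u v. bracket u v = - bracket v u"
  shows "bracket (p *\<^sub>R x + q *\<^sub>R y) (r *\<^sub>R x + s *\<^sub>R y) = (p * s - q * r) *\<^sub>R bracket x y"
proof -
  have "bracket y x = - bracket x y"
    by (rule skew)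
  then show ?thesis
    using assms(1) skew_bracket_self[of bracket, OF skew]
    by (simp add: bilinear_ladd bilinear_radd bilinear_lmul bilinear_rmul algebra_simps)
qed

text \<open>Every bracket is a multiple of \<open>e2\<close>, so each term reduces to the first coordinate of the
  outer vector times a determinant; the cyclic sum is a \<open>3 \<times> 3\<close> determinant with two equal rows.\<close>

lemma jacobi_on_plane:
  assumes "bilinear bracket" and skew: "\<And>u v. bracket u v = - bracket v u"
    and basis: "is_basis2 e1 e2" and e2: "bracket e1 e2 = e2"
  shows "bracket u (bracket v w) + bracket v (bracket w u) + bracket w (bracket u v) = 0"
proof -
  note det = bracket_determinant[of bracket, OF assms(1) skew]
  obtain u1 u2 where u: "u = u1 *\<^sub>R e1 + u2 *\<^sub>R e2"
    using basis by (rule is_basis2_coordinates)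
  obtain v1 v2 where v: "v = v1 *\<^sub>R e1 + v2 *\<^sub>R e2"
    using basis by (rule is_basis2_coordinates)
  obtain w1 w2 where w: "w = w1 *\<^sub>R e1 + w2 *\<^sub>R e2"
    using basis by (rule is_basis2_coordinates)
  have outer: "bracket (p *\<^sub>R e1 + q *\<^sub>R e2) (r *\<^sub>R e2) = (p * r) *\<^sub>R e2" for p q r
    using det[of p e1 q e2 0 r] e2 by simp
  have "u1 * (v1 * w2 - v2 * w1) + v1 * (w1 * u2 - w2 * u1) + w1 * (u1 * v2 - u2 * v1) = 0"
    by (simp add: algebra_simps)
  then show ?thesis
    unfolding u v w det e2 outer scaleR_add_left[symmetric] by simp
qed

section \<open>Almost complex structures on a plane\<close>

context almost_complex_hom_lie_algebra
begin

lemma J_J [simp]: "J (J x) = - x"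
  using J_squared by (metis comp_apply)

lemma phi_phi [simp]: "\<phi> (\<phi> x) = x"
  using involutive by (metis comp_apply id_apply)

lemma phi_J: "\<phi> (J x) = J (\<phi> x)"
  using phi_J_commute by (metis comp_apply)

text \<open>The map \<open>w \<mapsto> p w + q J w\<close> is multiplication by the complex number \<open>p + q i\<close>, whose
  determinant over the reals is its squared modulus.\<close>

lemma bracket_J_eq:
  assumes "u = p *\<^sub>R w + q *\<^sub>R J w"
  shows "bracket u (J u) = (p\<^sup>2 + q\<^sup>2) *\<^sub>R bracket w (J w)"
proof -
  have "J u = (- q) *\<^sub>R w + p *\<^sub>R J w"
    using assms linear_J by (simp add: linear_add linear_cmul)
  then have "bracket u (J u) = (p * p - q * (- q)) *\<^sub>R bracket w (J w)"
    using assms bracket_determinant[of bracket, OF bilinear_bracket skew] by metis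
  then show ?thesis
    by (simp add: power2_eq_square)
qed

text \<open>A relation \<open>J x = k x\<close> with \<open>k\<close> real would give \<open>k\<^sup>2 = -1\<close>.\<close>

lemma spanning_with_J:
  assumes "dim (UNIV :: 'g set) = 2" "x \<noteq> 0"
  shows "is_basis2 x (J x)"
proof -
  have "J x \<noteq> k *\<^sub>R x" for k
  proof
    assume k: "J x = k *\<^sub>R x"
    then have "- x = k *\<^sub>R k *\<^sub>R x"
      using linear_J by (metis J_J linear_cmul)
    then have "(k * k + 1) *\<^sub>R x = 0"
      by (metis add.left_inverse scaleR_add_left scaleR_one scaleR_scaleR add.commute)
    moreover have "k * k + 1 \<noteq> 0"
      by (smt (verit) zero_le_square)
    ultimately show False
      using assms(2) by simp
  qed
  then have "J x \<notin> span {x}"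
    by (auto simp: span_singleton)
  with assms show ?thesis
    by (rule is_basis2_if_not_in_span)
qed

text \<open>Because \<open>\<phi>\<close> is an involution, every \<open>\<phi> x + x\<close> is a fixed vector. If one of them is nonzero, it
  and its image under \<open>J\<close> form a fixed basis. If all vanish, \<open>\<phi> = -id\<close>, and applying \<open>\<phi>\<close> to a
  bracket gives both \<open>-[u, v]\<close> and \<open>[-u, -v] = [u, v]\<close>.\<close>

lemma phi_eq_identity:
  assumes "dim (UNIV :: 'g set) = 2" "non_abelian bracket"
  shows "\<phi> = id"
proof (cases "\<exists>x. \<phi> x + x \<noteq> 0")
  case True
  then obtain x where "\<phi> x + x \<noteq> 0"
    by blast
  then have "is_basis2 (\<phi> x + x) (J (\<phi> x + x))"
    using assms(1) spanning_with_J by blast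
  moreover have "\<phi> (\<phi> x + x) = \<phi> x + x"
    using linear_phi by (simp add: linear_add)
  moreover from this have "\<phi> (J (\<phi> x + x)) = J (\<phi> x + x)"
    by (simp add: phi_J)
  ultimately show ?thesis
    using linear_eq_on_basis2[OF linear_phi linear_id] by simp
next
  case False
  then have neg: "\<phi> x = - x" for x
    by (simp add: eq_neg_iff_add_eq_0)
  have "bracket u v = 0" for u v
  proof -
    have "bracket u v = - bracket u v"
      using phi_bracket[of u v] bilinear_bracket
      by (simp add: neg bilinear_lneg bilinear_rneg)
    then show ?thesis
      by (rule eq_minus_self_imp_zero)
  qed
  with assms(2) show ?thesis
    by (simp add: non_abelian_def)
qed

text \<open>The vector \<open>w = [u, J u]\<close> spans all brackets, so \<open>e2\<close> has to be proportional to it. Taking \<open>e1\<close>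
  on the line of \<open>J w\<close> leaves one scale to adjust, and \<open>J\<close> then exchanges the two coordinate
  axes.\<close>

lemma normal_form_basis:
  assumes dim: "dim (UNIV :: 'g set) = 2" and "non_abelian bracket"
  obtains e1 e2 m where "is_basis2 e1 e2" "bracket e1 e2 = e2" "m \<noteq> 0"
    "J e1 = m *\<^sub>R e2" "J e2 = (- 1 / m) *\<^sub>R e1"
proof -
  obtain u v where uv: "bracket u v \<noteq> 0"
    using assms(2) by (auto simp: non_abelian_def)
  then have "u \<noteq> 0"
    using bilinear_bracket bilinear_lzero by blast
  then have "is_basis2 u (J u)"
    using dim spanning_with_J by blast
  then obtain r s where "v = r *\<^sub>R u + s *\<^sub>R J u"
    by (rule is_basis2_coordinates)
  then have "bracket u v = s *\<^sub>R bracket u (J u)"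
    using bracket_determinant[of bracket 1 u 0 "J u" r s, OF bilinear_bracket skew] by simp
  define w where "w = bracket u (J u)"
  have "w \<noteq> 0"
    using uv \<open>bracket u v = _\<close> by (auto simp: w_def)
  then have "is_basis2 w (J w)"
    using dim spanning_with_J by blast
  then obtain p q where pq: "u = p *\<^sub>R w + q *\<^sub>R J w"
    by (rule is_basis2_coordinates)
  define m where "m = p\<^sup>2 + q\<^sup>2"
  have w: "w = m *\<^sub>R bracket w (J w)"
    using bracket_J_eq[OF pq] by (simp add: w_def m_def)
  then have "m \<noteq> 0"
    using \<open>w \<noteq> 0\<close> by (metis scaleR_zero_left)
  \<comment> \<open>The factor \<open>- m\<close> and skew-symmetry turn \<open>w = m [w, J w]\<close> into \<open>[e1, w] = w\<close>.\<close>
  define e1 where "e1 = (- m) *\<^sub>R J w"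
  have J_e1: "J e1 = m *\<^sub>R w"
    using linear_J by (simp add: e1_def linear_cmul linear_neg)
  have "e1 \<noteq> 0"
    using J_e1 \<open>m \<noteq> 0\<close> \<open>w \<noteq> 0\<close> linear_0[OF linear_J] by auto
  have "is_basis2 e1 w"
  proof -
    have "w \<notin> span {J w}"
      using \<open>is_basis2 w (J w)\<close> by (simp add: is_basis2_def independent_insert)
    moreover have "e1 \<in> span {J w}"
      unfolding e1_def by (intro span_scale span_base) simp
    then have "span {e1} \<subseteq> span {J w}"
      by (intro span_minimal) simp_all
    ultimately have "w \<notin> span {e1}"
      by blast
    with dim \<open>e1 \<noteq> 0\<close> show ?thesis
      by (rule is_basis2_if_not_in_span)
  qed
  moreover have "bracket e1 w = w"
  proof -
    have "bracket e1 w = m *\<^sub>R bracket w (J w)"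
      using bilinear_bracket skew[of "J w" w]
      by (simp add: e1_def bilinear_lmul bilinear_lneg)
    also have "\<dots> = w"
      by (rule w[symmetric])
    finally show ?thesis .
  qed
  moreover have "J w = (- 1 / m) *\<^sub>R e1"
    using \<open>m \<noteq> 0\<close> by (simp add: e1_def)
  ultimately show thesis
    using that J_e1 \<open>m \<noteq> 0\<close> by blast
qed

end

section \<open>The classification\<close>

theorem proposition3p4:
  fixes bracket :: "'g::real_vector \<Rightarrow> 'g \<Rightarrow> 'g"
    and \<phi> J :: "'g \<Rightarrow> 'g"
  shows "(dim (UNIV :: 'g set) = 2 \<and> almost_complex_hom_lie_algebra bracket \<phi> J \<and> non_abelian bracket)
     \<longleftrightarrow>
     (bilinear bracket \<and> (\<forall>u v. bracket u v = - bracket v u) \<and> linear \<phi> \<and> linear J \<and>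
      (\<exists>e1 e2. is_basis2 e1 e2 \<and> bracket e1 e2 = e2 \<and> \<phi> e1 = e1 \<and> \<phi> e2 = e2 \<and>
        (\<exists>a b c :: real. a\<^sup>2 + b * c = - 1 \<and>
           J e1 = a *\<^sub>R e1 + b *\<^sub>R e2 \<and> J e2 = c *\<^sub>R e1 - a *\<^sub>R e2)))"
    (is "?L \<longleftrightarrow> ?R")
proof
  assume L: ?L
  then interpret almost_complex_hom_lie_algebra bracket \<phi> J
    by simp
  obtain e1 e2 m where basis: "is_basis2 e1 e2" "bracket e1 e2 = e2"
    and m: "m \<noteq> 0" "J e1 = m *\<^sub>R e2" "J e2 = (- 1 / m) *\<^sub>R e1"
    using L normal_form_basis by blast
  have "\<phi> = id"
    using L phi_eq_identity by blast
  have "0\<^sup>2 + m * (- 1 / m) = - 1" "J e1 = 0 *\<^sub>R e1 + m *\<^sub>R e2"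
    "J e2 = (- 1 / m) *\<^sub>R e1 - 0 *\<^sub>R e2"
    using m by simp_all
  then have "\<exists>a b c :: real. a\<^sup>2 + b * c = - 1 \<and>
      J e1 = a *\<^sub>R e1 + b *\<^sub>R e2 \<and> J e2 = c *\<^sub>R e1 - a *\<^sub>R e2"
    by blast
  moreover have "\<forall>u v. bracket u v = - bracket v u"
    using skew by blast
  moreover have "\<phi> e1 = e1" "\<phi> e2 = e2"
    using \<open>\<phi> = id\<close> by simp_all
  ultimately show ?R
    using bilinear_bracket linear_phi linear_J basis by blast
next
  assume R: ?R
  then have bil: "bilinear bracket" and skew: "\<And>u v. bracket u v = - bracket v u"
    and lin: "linear \<phi>" "linear J"
    by blast+
  from R obtain e1 e2 a b c where basis: "is_basis2 e1 e2" and e2: "bracket e1 e2 = e2"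
    and phi: "\<phi> e1 = e1" "\<phi> e2 = e2" and abc: "a\<^sup>2 + b * c = - 1"
    and J: "J e1 = a *\<^sub>R e1 + b *\<^sub>R e2" "J e2 = c *\<^sub>R e1 - a *\<^sub>R e2"
    by blast
  have "\<phi> = id"
    using phi by (intro linear_eq_on_basis2[OF lin(1) linear_id basis]) simp_all
  have J_J: "J \<circ> J = uminus"
  proof (rule linear_eq_on_basis2[OF _ _ basis])
    show "linear (J \<circ> J)"
      using lin(2) lin(2) by (rule linear_compose)
    show "linear (uminus :: 'g \<Rightarrow> 'g)"
      by (rule linear_uminus)
    have "(J \<circ> J) e1 = (a\<^sup>2 + b * c) *\<^sub>R e1"
      using lin(2) by (simp add: J linear_add linear_cmul algebra_simps power2_eq_square)
    then show "(J \<circ> J) e1 = - e1"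
      by (simp add: abc)
    have "(J \<circ> J) e2 = (a\<^sup>2 + b * c) *\<^sub>R e2"
      using lin(2) by (simp add: J linear_diff linear_cmul algebra_simps power2_eq_square)
    then show "(J \<circ> J) e2 = - e2"
      by (simp add: abc)
  qed
  have "bij J"
  proof (rule o_bij)
    show "(uminus \<circ> J) \<circ> J = id" "J \<circ> (uminus \<circ> J) = id"
      using J_J lin(2) by (auto simp: fun_eq_iff linear_neg)
  qed
  have "almost_complex_hom_lie_algebra bracket \<phi> J"
  proof
    show "bracket u v = - bracket v u" for u v
      by (rule skew)
    show "bracket (\<phi> u) (bracket v w) + bracket (\<phi> v) (bracket w u) + bracket (\<phi> w) (bracket u v) = 0"
      for u v w
      using jacobi_on_plane[of bracket, OF bil skew basis e2] by (simp add: \<open>\<phi> = id\<close>)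
  qed (use bil lin \<open>bij J\<close> J_J \<open>\<phi> = id\<close> in
      \<open>simp_all add: linear_add linear_cmul\<close>)
  moreover have "e2 \<noteq> 0"
    using basis dependent_zero[of "{e1, e2}"] by (auto simp: is_basis2_def)
  then have "non_abelian bracket"
    using e2 unfolding non_abelian_def by metis
  ultimately show ?L
    using dim_UNIV_eq_2_if_is_basis2[OF basis] by blast
qed

end
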